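(* Let $X$ be a finite skew brace, let $I$ be an ideal of $X$ and assume that $X/I$ is left nilpotent. Then the left series $(I_n^X)_{n\ge0}$ of $I$ relative to $X$ eventually reaches $L_\infty(X)$ (that is, $I_n^X=L_\infty(X)$ for all sufficiently large $n$). Consequently, for an ideal $I$ of $X$, $X$ is left nilpotent if and only if $X/I$ is left nilpotent and $I_n^X=0$ for some $n$.
   Context: A skew (left) brace is a triple $X=(X,+,\cdot)$ such that $(X,+)$ and $(X,\cdot)$ are groups on the same set and $a\cdot(b+c)=a\cdot b-a+a\cdot c$ for all $a,b,c\in X$. The common identity is $0$. Put $\lambda_a(b)=-a+a\cdot b$ and $a*b=\lambda_a(b)-b$; for subsets $S,T$, $S*T$ is the subgroup of $(X,+)$ generated by all $s*t$, $s\in S$, $t\in T$. An ideal of $X$ is a subgroup of $(X,+)$ that is invariant under every $\lambda_a$ and normal in both $(X,+)$ and $(X,\cdot)$. The left series is $X^1=X$, $X^{n+1}=X*X^n$; $X$ is left nilpotent if $X^n=0$ for some $n$; $L_\infty(X)=\bigcap_{n\ge1}X^n$. For an ideal $I$ of $X$, the left series of $I$ relative to $X$ is $I_0^X=I$, $I_{n+1}^X=X*I_n^X$ for $n\ge0$; it is a descending chain. *)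

theory Defs
  imports "HOL-Algebra.QuotRing" "HOL-Algebra.Generated_Groups"
begin

text \<open>
  A skew brace is carried by a record of type \<open>ring\<close>, which provides the two operations
  \<open>\<oplus>\<close> and \<open>\<otimes>\<close> on a common carrier. None of the ring axioms is assumed; in particular
  \<open>\<oplus>\<close> need not be commutative, and \<open>a \<ominus> b\<close> is \<open>a \<oplus> (\<ominus> b)\<close>. The fields \<open>\<zero>\<close> and \<open>\<one>\<close> are the
  identities of the two groups; that they coincide is \<open>skew_brace.one_eq_zero\<close>.
\<close>

locale skew_brace = group B for B (structure) +
  assumes a_group: "group (add_monoid B)"
    and brace_distr: "\<lbrakk>a \<in> carrier B; b \<in> carrier B; c \<in> carrier B\<rbrakk>
      \<Longrightarrow> a \<otimes> (b \<oplus> c) = a \<otimes> b \<ominus> a \<oplus> a \<otimes> c"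

definition brace_lambda :: "('a, 'm) ring_scheme \<Rightarrow> 'a \<Rightarrow> 'a \<Rightarrow> 'a"
  where "brace_lambda B a b = \<ominus>\<^bsub>B\<^esub> a \<oplus>\<^bsub>B\<^esub> a \<otimes>\<^bsub>B\<^esub> b"

definition brace_star :: "('a, 'm) ring_scheme \<Rightarrow> 'a \<Rightarrow> 'a \<Rightarrow> 'a"
  where "brace_star B a b = brace_lambda B a b \<ominus>\<^bsub>B\<^esub> b"

definition brace_star_set :: "('a, 'm) ring_scheme \<Rightarrow> 'a set \<Rightarrow> 'a set \<Rightarrow> 'a set"
  where "brace_star_set B S T =
    generate (add_monoid B) {brace_star B s t | s t. s \<in> S \<and> t \<in> T}"

definition brace_ideal :: "'a set \<Rightarrow> ('a, 'm) ring_scheme \<Rightarrow> bool"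
  where "brace_ideal I B \<longleftrightarrow>
    subgroup I (add_monoid B) \<and>
    (\<forall>a\<in>carrier B. \<forall>b\<in>I. brace_lambda B a b \<in> I) \<and>
    I \<lhd> add_monoid B \<and> I \<lhd> B"

text \<open>
  \<open>left_series B n\<close> is $B^n$ for $n \ge 1$; the value at \<open>0\<close> is a dummy that is never used.
\<close>

fun left_series :: "('a, 'm) ring_scheme \<Rightarrow> nat \<Rightarrow> 'a set"
  where
    "left_series B 0 = carrier B"
  | "left_series B (Suc 0) = carrier B"
  | "left_series B (Suc (Suc n)) = brace_star_set B (carrier B) (left_series B (Suc n))"

definition left_nilpotent :: "('a, 'm) ring_scheme \<Rightarrow> bool"
  where "left_nilpotent B \<longleftrightarrow> (\<exists>n\<ge>1. left_series B n = {\<zero>\<^bsub>B\<^esub>})"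

definition left_series_limit :: "('a, 'm) ring_scheme \<Rightarrow> 'a set"
  where "left_series_limit B = (\<Inter>n\<in>{1..}. left_series B n)"

primrec rel_left_series :: "('a, 'm) ring_scheme \<Rightarrow> 'a set \<Rightarrow> nat \<Rightarrow> 'a set"
  where
    "rel_left_series B I 0 = I"
  | "rel_left_series B I (Suc n) = brace_star_set B (carrier B) (rel_left_series B I n)"

text \<open>
  The quotient skew brace $B/I$ is the library's \<open>B Quot I\<close>: its elements are the additive cosets
  of \<open>I\<close>, with the operations induced by representatives. Despite the name, this construction
  needs no ring axioms; lemma \<open>skew_brace.quotient_skew_brace\<close> below shows that it is a skew
  brace whose additive and multiplicative groups are the factor groups by \<open>I\<close>.
\<close>

context skew_brace
begin

interpretation add: group "add_monoid B"
  rewrites "carrier (add_monoid B) = carrier B"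
    and "mult (add_monoid B) = add B"
    and "one (add_monoid B) = \<zero>"
    and "m_inv (add_monoid B) = a_inv B"
  by (simp_all add: a_group a_inv_def fun_eq_iff)

lemma one_eq_zero: "\<one> = \<zero>"
proof -
  have "\<one> \<otimes> (\<zero> \<oplus> \<zero>) = \<one> \<otimes> \<zero> \<ominus> \<one> \<oplus> \<one> \<otimes> \<zero>"
    by (intro brace_distr) auto
  then have "\<zero> = \<ominus> \<one>"
    by (simp add: a_minus_def)
  then show ?thesis
    by (metis add.inv_inv add.inv_one one_closed)
qed

lemma mult_eq_add_lambda:
  assumes "a \<in> carrier B" "b \<in> carrier B"
  shows "a \<otimes> b = a \<oplus> brace_lambda B a b"
  using assms by (simp add: brace_lambda_def add.m_assoc [symmetric])

lemma brace_lambda_inv: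
  assumes a: "a \<in> carrier B" and b: "b \<in> carrier B"
  shows "brace_lambda B a (brace_lambda B (inv a) b) = b"
proof -
  let ?c = "brace_lambda B (inv a) b"
  have c: "?c \<in> carrier B"
    using a b by (simp add: brace_lambda_def)
  have "b = a \<otimes> (inv a \<otimes> b)"
    using a b by (simp add: m_assoc [symmetric])
  also have "\<dots> = a \<otimes> (inv a \<oplus> ?c)"
    using a b by (simp add: mult_eq_add_lambda)
  also have "\<dots> = a \<otimes> inv a \<ominus> a \<oplus> a \<otimes> ?c"
    using a c by (simp add: brace_distr)
  also have "\<dots> = brace_lambda B a ?c"
    using a c by (simp add: one_eq_zero a_minus_def brace_lambda_def)
  finally show ?thesis by simp
qed

lemma ideal_cosets_eq:
  assumes I: "brace_ideal I B" and a: "a \<in> carrier B"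
  shows "I +> a = I #> a"
proof -
  interpret N: normal I B using I by (simp add: brace_ideal_def)
  interpret A: normal I "add_monoid B" using I by (simp add: brace_ideal_def)
  have lam: "brace_lambda B x i \<in> I" if "x \<in> carrier B" "i \<in> I" for x i
    using I that by (auto simp: brace_ideal_def)
  have sub: "I \<subseteq> carrier B" by (rule N.subset)
  have "I +> a = (\<lambda>i. a \<oplus> i) ` I"
    using A.coset_eq a by (auto simp: a_r_coset_def l_coset_def)
  also have "\<dots> = (\<lambda>i. a \<otimes> i) ` I"
  proof (intro equalityI subsetI; elim imageE)
    fix x i assume x: "x = a \<oplus> i" and i: "i \<in> I"
    then have "x = a \<otimes> brace_lambda B (inv a) i"
      using a sub lam [of "inv a" i] by (auto simp: mult_eq_add_lambda brace_lambda_inv subset_iff)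
    then show "x \<in> (\<lambda>i. a \<otimes> i) ` I" using lam a i by auto
  next
    fix x i assume x: "x = a \<otimes> i" and i: "i \<in> I"
    then show "x \<in> (\<lambda>i. a \<oplus> i) ` I"
      using a sub lam [of a i] by (auto simp: mult_eq_add_lambda subset_iff)
  qed
  also have "\<dots> = I #> a"
    using N.coset_eq a by (auto simp: l_coset_def)
  finally show ?thesis .
qed

lemma quotient_skew_brace:
  assumes I: "brace_ideal I B"
  shows "skew_brace (B Quot I)"
    and "add_monoid (B Quot I) = add_monoid B Mod I"
    and "carrier (B Quot I) = carrier (B Mod I)"
    and "\<lbrakk>a \<in> carrier B; b \<in> carrier B\<rbrakk>
      \<Longrightarrow> (I +> a) \<otimes>\<^bsub>B Quot I\<^esub> (I +> b) = I +> (a \<otimes> b)"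
    and "\<lbrakk>a \<in> carrier B; b \<in> carrier B\<rbrakk>
      \<Longrightarrow> (I +> a) \<oplus>\<^bsub>B Quot I\<^esub> (I +> b) = I +> (a \<oplus> b)"
proof -
  interpret N: normal I B using I by (simp add: brace_ideal_def)
  interpret A: normal I "add_monoid B" using I by (simp add: brace_ideal_def)
  note co = ideal_cosets_eq [OF I]
  show addg: "add_monoid (B Quot I) = add_monoid B Mod I"
    by (simp add: FactRing_def FactGroup_def A_RCOSETS_def set_add_def)
  have car: "carrier (B Quot I) = (\<lambda>a. I +> a) ` carrier B"
    by (auto simp: FactRing_def A_RCOSETS_def RCOSETS_def a_r_coset_def)
  show carM: "carrier (B Quot I) = carrier (B Mod I)"
    unfolding car using co by (auto simp: FactGroup_def RCOSETS_def)
  have mul: "(I +> a) \<otimes>\<^bsub>B Quot I\<^esub> (I +> b) = I +> (a \<otimes> b)"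
    and mulM: "(I +> a) \<otimes>\<^bsub>B Mod I\<^esub> (I +> b) = I +> (a \<otimes> b)"
    if ab: "a \<in> carrier B" "b \<in> carrier B" for a b
  proof -
    have prod: "(I #> a) <#> (I #> b) = I #> (a \<otimes> b)"
      using ab by (rule N.rcos_sum)
    then show "(I +> a) \<otimes>\<^bsub>B Mod I\<^esub> (I +> b) = I +> (a \<otimes> b)"
      using ab by (simp add: co FactGroup_def)
    have "I +> (x \<otimes> y) = I #> (a \<otimes> b)" if xy: "x \<in> I #> a" "y \<in> I #> b" for x y
    proof -
      have c: "x \<in> carrier B" "y \<in> carrier B"
        using xy ab r_coset_subset_G [OF N.subset] by blast+
      have "x \<otimes> y \<in> I #> (a \<otimes> b)"
        using xy prod by (force simp: set_mult_def)
      then show ?thesis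
        using ab c repr_independence [OF _ _ N.subgroup_axioms] by (simp add: co)
    qed
    moreover have "a \<in> I #> a" "b \<in> I #> b"
      using ab rcos_self N.subgroup_axioms by blast+
    ultimately have "(\<Union>x\<in>I #> a. \<Union>y\<in>I #> b. I +> (x \<otimes> y)) = I #> (a \<otimes> b)"
      by blast
    then show "(I +> a) \<otimes>\<^bsub>B Quot I\<^esub> (I +> b) = I +> (a \<otimes> b)"
      using ab by (simp add: co FactRing_def rcoset_mult_def)
  qed
  have add: "(I +> a) \<oplus>\<^bsub>B Quot I\<^esub> (I +> b) = I +> (a \<oplus> b)"
    if "a \<in> carrier B" "b \<in> carrier B" for a b
    using A.rcos_sum [of a b] that by (simp add: FactRing_def set_add_def a_r_coset_def)
  show "\<lbrakk>a \<in> carrier B; b \<in> carrier B\<rbrakk>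
      \<Longrightarrow> (I +> a) \<otimes>\<^bsub>B Quot I\<^esub> (I +> b) = I +> (a \<otimes> b)" by (rule mul)
  show "\<lbrakk>a \<in> carrier B; b \<in> carrier B\<rbrakk>
      \<Longrightarrow> (I +> a) \<oplus>\<^bsub>B Quot I\<^esub> (I +> b) = I +> (a \<oplus> b)" by (rule add)
  have one: "\<one>\<^bsub>B Quot I\<^esub> = I +> \<one>" by (simp add: FactRing_def)
  have agrp: "group (add_monoid (B Quot I))"
    unfolding addg by (rule A.factorgroup_is_group)
  interpret Q: group "add_monoid (B Quot I)" by (rule agrp)
  have neg: "\<ominus>\<^bsub>B Quot I\<^esub> (I +> a) = I +> (\<ominus> a)" if a: "a \<in> carrier B" for a
  proof -
    have "\<zero>\<^bsub>B Quot I\<^esub> = I +> \<zero>"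
      using coset_mult_one N.subset by (simp add: co one_eq_zero [symmetric] FactRing_def)
    then show ?thesis
      using a Q.inv_equality [of "I +> (\<ominus> a)" "I +> a"] by (simp add: car add a_inv_def [of "B Quot I"])
  qed
  show "skew_brace (B Quot I)"
  proof (intro skew_brace.intro skew_brace_axioms.intro)
    show "group (B Quot I)"
    proof (rule groupI)
      fix x assume "x \<in> carrier (B Quot I)"
      then obtain a where a: "a \<in> carrier B" "x = I +> a" by (auto simp: car)
      then have "(I +> inv a) \<otimes>\<^bsub>B Quot I\<^esub> x = \<one>\<^bsub>B Quot I\<^esub>"
        by (simp add: mul one)
      then show "\<exists>y\<in>carrier (B Quot I). y \<otimes>\<^bsub>B Quot I\<^esub> x = \<one>\<^bsub>B Quot I\<^esub>"
        using a by (auto simp: car)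
    qed (auto simp: car mul one m_assoc)
    show "group (add_monoid (B Quot I))" by (rule agrp)
    fix a b c
    assume "a \<in> carrier (B Quot I)" "b \<in> carrier (B Quot I)" "c \<in> carrier (B Quot I)"
    then show "a \<otimes>\<^bsub>B Quot I\<^esub> (b \<oplus>\<^bsub>B Quot I\<^esub> c) =
        a \<otimes>\<^bsub>B Quot I\<^esub> b \<ominus>\<^bsub>B Quot I\<^esub> a \<oplus>\<^bsub>B Quot I\<^esub> a \<otimes>\<^bsub>B Quot I\<^esub> c"
      by (auto simp: car mul add neg a_minus_def brace_distr)
  qed
qed

end

end

theory Submission
  imports Defs
begin

text \<open>
  Write \<open>X\<close> for the skew brace. The operation \<open>S \<mapsto> X * S\<close> is monotone, and both series iterate it:
  the left series from \<open>X\<close> and the relative one from \<open>I\<close>. Iterating it on \<open>I \<subseteq> X\<close> gives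
  \<open>I\<^sub>n \<subseteq> X\<^sup>n\<^sup>+\<^sup>1\<close>. The projection \<open>X \<rightarrow> X/I\<close> is a homomorphism for both
  operations, so it maps the left series of \<open>X\<close> onto the left series of \<open>X/I\<close>. Hence left nilpotency of
  \<open>X/I\<close> means that \<open>X\<^sup>m \<subseteq> I\<close> for some \<open>m \<ge> 1\<close>, and iterating on this inclusion gives the sandwich
  \<open>X\<^sup>m\<^sup>+\<^sup>n \<subseteq> I\<^sub>n \<subseteq> X\<^sup>n\<^sup>+\<^sup>1\<close>.

  If \<open>X\<close> is finite, its left series, being descending, is constant from some index on, with value
  \<open>L\<^sub>\<infinity>(X)\<close>; the sandwich forces the same value upon \<open>I\<^sub>n\<close>. For the
  criterion, recall that all terms of both series contain \<open>0\<close>. If \<open>X\<^sup>n\<^sup>+\<^sup>1 = 0\<close>, then \<open>I\<^sub>n = 0\<close> by the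
  right-hand inclusion and \<open>X\<^sup>n\<^sup>+\<^sup>1 \<subseteq> I\<close>; if \<open>X\<^sup>m \<subseteq> I\<close> and \<open>I\<^sub>n = 0\<close>, then \<open>X\<^sup>m\<^sup>+\<^sup>n = 0\<close> by the left-hand one.
\<close>

lemma antimono_finite_stabilizes:
  fixes A :: "nat \<Rightarrow> 'a set"
  assumes dec: "antimono A" and fin: "finite (A 0)"
  obtains K where "\<And>n. n \<ge> K \<Longrightarrow> A n = A K"
proof -
  \<comment> \<open>A term of least cardinality cannot shrink any further.\<close>
  obtain K where K: "\<And>n. card (A K) \<le> card (A n)"
    using ex_has_least_nat [of "\<lambda>_. True" _ "\<lambda>n. card (A n)"] by auto
  have "A n = A K" if "n \<ge> K" for n
  proof (rule card_seteq)
    show "finite (A K)"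
      using antimonoD [OF dec, of 0 K] fin finite_subset by simp
    show "A n \<subseteq> A K"
      using dec that by (rule antimonoD)
    show "card (A K) \<le> card (A n)" by (rule K)
  qed
  then show ?thesis by (rule that)
qed

section \<open>Monotonicity and the two series\<close>

context skew_brace
begin

interpretation add: group "add_monoid B"
  rewrites "carrier (add_monoid B) = carrier B"
    and "mult (add_monoid B) = add B"
    and "one (add_monoid B) = \<zero>"
    and "m_inv (add_monoid B) = a_inv B"
  by (simp_all add: a_group a_inv_def fun_eq_iff)

lemma brace_star_set_mono:
  "T \<subseteq> T' \<Longrightarrow> brace_star_set B S T \<subseteq> brace_star_set B S T'"
  unfolding brace_star_set_def by (rule add.mono_generate) blast

lemma left_series_Suc:
  "n \<ge> 1 \<Longrightarrow> left_series B (Suc n) = brace_star_set B (carrier B) (left_series B n)"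
  by (cases n) simp_all

text \<open>
  The index must start at \<open>m \<ge> 1\<close>: by convention the terms at \<open>0\<close> and \<open>1\<close> are both the whole carrier,
  so that the recursion \<open>X\<^sup>k\<^sup>+\<^sup>1 = X * X\<^sup>k\<close> starts only there.
\<close>

lemma left_series_subset_rel_left_series:
  assumes "left_series B m \<subseteq> I" and "m \<ge> 1"
  shows "left_series B (m + n) \<subseteq> rel_left_series B I n"
proof (induction n)
  case (Suc n)
  then show ?case
    using assms(2) by (simp add: left_series_Suc brace_star_set_mono)
qed (use assms in simp)

lemma rel_left_series_subset_left_series:
  assumes "I \<subseteq> carrier B"
  shows "rel_left_series B I n \<subseteq> left_series B (Suc n)"
  by (induction n) (simp_all add: assms brace_star_set_mono)

lemma brace_star_closed:
  "\<lbrakk>a \<in> carrier B; b \<in> carrier B\<rbrakk> \<Longrightarrow> brace_star B a b \<in> carrier B"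
  by (simp add: brace_star_def brace_lambda_def a_minus_def)

lemma brace_star_set_closed:
  assumes "S \<subseteq> carrier B" "T \<subseteq> carrier B"
  shows "brace_star_set B S T \<subseteq> carrier B"
  unfolding brace_star_set_def
  by (rule add.generate_incl) (use assms brace_star_closed in blast)

lemma left_series_closed: "left_series B n \<subseteq> carrier B"
proof (induction n)
  case (Suc n)
  then show ?case
    by (cases n) (simp_all add: brace_star_set_closed)
qed simp

lemma zero_in_left_series: "\<zero> \<in> left_series B n"
proof (cases n)
  case (Suc k)
  then show ?thesis
    using generate.one [of "add_monoid B"] by (cases k) (simp_all add: brace_star_set_def)
qed simp

lemma zero_in_rel_left_series:
  assumes "\<zero> \<in> I"
  shows "\<zero> \<in> rel_left_series B I n"
  by (cases n) (use assms generate.one [of "add_monoid B"] in \<open>simp_all add: brace_star_set_def\<close>)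

text \<open>
  The inclusion \<open>X\<^sup>2 \<subseteq> X\<^sup>1\<close> is clear, and monotonicity of \<open>S \<mapsto> X * S\<close> propagates it along the
  series.
\<close>

lemma antimono_left_series: "antimono (left_series B)"
proof (rule antimonoI)
  have "left_series B (Suc n) \<subseteq> left_series B n" for n
  proof (induction n)
    case (Suc n)
    show ?case
    proof (cases "n = 0")
      case True
      then show ?thesis
        using left_series_closed [of "Suc (Suc n)"] by simp
    next
      case False
      then have "left_series B (Suc n) = brace_star_set B (carrier B) (left_series B n)"
        by (intro left_series_Suc) simp
      moreover have "left_series B (Suc (Suc n)) = brace_star_set B (carrier B) (left_series B (Suc n))"
        by (rule left_series.simps)
      ultimately show ?thesis
        using brace_star_set_mono [OF Suc.IH, of "carrier B"] by (simp only:)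
    qed
  qed simp
  then show "left_series B n \<subseteq> left_series B m" if "m \<le> n" for m n
    using that by (rule lift_Suc_antimono_le)
qed

lemma left_series_stabilizes:
  assumes "finite (carrier B)"
  obtains K where "\<And>n. n \<ge> K \<Longrightarrow> left_series B n = left_series_limit B"
proof -
  obtain K where K: "\<And>n. n \<ge> K \<Longrightarrow> left_series B n = left_series B K"
    using antimono_finite_stabilizes [OF antimono_left_series] assms left_series.simps(1) by metis
  have "left_series B K \<subseteq> left_series B n" for n
    using K [of n] antimonoD [OF antimono_left_series, of n K] by (cases "n \<ge> K") auto
  moreover have "left_series_limit B \<subseteq> left_series B (Suc K)"
    by (auto simp: left_series_limit_def)
  ultimately have "left_series_limit B = left_series B K"
    using K [of "Suc K"] by (auto simp: left_series_limit_def)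
  then show ?thesis
    using K by (intro that [of K]) metis
qed

section \<open>The left series of a quotient\<close>

lemma quotient_map_group_hom:
  assumes I: "brace_ideal I B"
  shows "group_hom (add_monoid B) (add_monoid (B Quot I)) (\<lambda>a. I +> a)"
proof -
  interpret A: normal I "add_monoid B" using I by (simp add: brace_ideal_def)
  show ?thesis
    unfolding quotient_skew_brace(2) [OF I] a_r_coset_def
    by (intro group_hom.intro group_hom_axioms.intro a_group
        A.factorgroup_is_group A.r_coset_hom_Mod)
qed

lemma carrier_quotient: "carrier (B Quot I) = (\<lambda>a. I +> a) ` carrier B"
  by (auto simp: FactRing_def A_RCOSETS_def RCOSETS_def a_r_coset_def)

lemma brace_star_quotient:
  assumes I: "brace_ideal I B" and a: "a \<in> carrier B" and b: "b \<in> carrier B"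
  shows "brace_star (B Quot I) (I +> a) (I +> b) = I +> brace_star B a b"
proof -
  interpret h: group_hom "add_monoid B" "add_monoid (B Quot I)" "\<lambda>a. I +> a"
    by (rule quotient_map_group_hom [OF I])
  have neg: "\<ominus>\<^bsub>B Quot I\<^esub> (I +> x) = I +> (\<ominus> x)" if "x \<in> carrier B" for x
    using h.hom_inv [of x] that by (simp add: a_inv_def)
  show ?thesis
    using a b quotient_skew_brace(4,5) [OF I]
    by (simp add: brace_star_def brace_lambda_def a_minus_def neg)
qed

text \<open>
  The projection preserves \<open>*\<close> on elements, hence maps generators onto generators; and the
  image of a generated subgroup is generated by the images.
\<close>

lemma brace_star_set_quotient:
  assumes I: "brace_ideal I B" and S: "S \<subseteq> carrier B" and T: "T \<subseteq> carrier B"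
  shows "brace_star_set (B Quot I) ((\<lambda>a. I +> a) ` S) ((\<lambda>a. I +> a) ` T) =
    (\<lambda>a. I +> a) ` brace_star_set B S T"
proof -
  interpret h: group_hom "add_monoid B" "add_monoid (B Quot I)" "\<lambda>a. I +> a"
    by (rule quotient_map_group_hom [OF I])
  let ?gens = "{brace_star B s t | s t. s \<in> S \<and> t \<in> T}"
  have star: "brace_star (B Quot I) (I +> s) (I +> t) = I +> brace_star B s t"
    if "s \<in> S" "t \<in> T" for s t
    using brace_star_quotient [OF I] S T that by blast
  have gens: "{brace_star (B Quot I) s t | s t. s \<in> (\<lambda>a. I +> a) ` S \<and> t \<in> (\<lambda>a. I +> a) ` T} =
      (\<lambda>a. I +> a) ` ?gens"
  proof (intro equalityI subsetI)
    fix x assume "x \<in> {brace_star (B Quot I) s t | s t. s \<in> (\<lambda>a. I +> a) ` S \<and> t \<in> (\<lambda>a. I +> a) ` T}"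
    then obtain s t where "s \<in> S" "t \<in> T" "x = brace_star (B Quot I) (I +> s) (I +> t)"
      by blast
    then show "x \<in> (\<lambda>a. I +> a) ` ?gens"
      using star by blast
  next
    fix x assume "x \<in> (\<lambda>a. I +> a) ` ?gens"
    then obtain s t where "s \<in> S" "t \<in> T" "x = I +> brace_star B s t"
      by blast
    then show "x \<in> {brace_star (B Quot I) s t | s t. s \<in> (\<lambda>a. I +> a) ` S \<and> t \<in> (\<lambda>a. I +> a) ` T}"
      using star [symmetric] by blast
  qed
  have sub: "?gens \<subseteq> carrier B"
    using S T brace_star_closed by auto
  show ?thesis
    unfolding brace_star_set_def gens by (rule h.generate_img [OF sub])
qed

lemma left_series_quotient:
  assumes I: "brace_ideal I B"
  shows "left_series (B Quot I) n = (\<lambda>a. I +> a) ` left_series B n"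
proof (induction n)
  case (Suc n)
  then show ?case
    using brace_star_set_quotient [OF I subset_refl left_series_closed]
    by (cases n) (simp_all add: carrier_quotient)
qed (simp add: carrier_quotient)

lemma left_series_quotient_eq_zero_iff:
  assumes I: "brace_ideal I B"
  shows "left_series (B Quot I) n = {\<zero>\<^bsub>B Quot I\<^esub>} \<longleftrightarrow> left_series B n \<subseteq> I"
proof -
  interpret A: normal I "add_monoid B" using I by (simp add: brace_ideal_def)
  have coset: "I +> a = I \<longleftrightarrow> a \<in> I" if "a \<in> carrier B" for a
    using that group.coset_join1 [OF a_group _ _ A.subgroup_axioms, of a]
      group.coset_join2 [OF a_group _ A.subgroup_axioms, of a]
    by (auto simp: a_r_coset_def)
  have "(\<lambda>a. I +> a) ` left_series B n = {I} \<longleftrightarrow> (\<forall>a \<in> left_series B n. I +> a = I)"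
    using zero_in_left_series [of n] by blast
  also have "\<dots> \<longleftrightarrow> left_series B n \<subseteq> I"
    using coset left_series_closed [of n] by blast
  finally show ?thesis
    unfolding left_series_quotient [OF I] by (simp add: FactRing_def)
qed

lemma left_nilpotent_quotient_iff:
  assumes "brace_ideal I B"
  shows "left_nilpotent (B Quot I) \<longleftrightarrow> (\<exists>m\<ge>1. left_series B m \<subseteq> I)"
  unfolding left_nilpotent_def left_series_quotient_eq_zero_iff [OF assms] by (rule refl)

section \<open>Comparison of the two series\<close>

text \<open>
  From the index \<open>K\<close> at which the left series becomes stationary, both bounds in
  \<open>X\<^sup>m\<^sup>+\<^sup>n \<subseteq> I\<^sub>n \<subseteq> X\<^sup>n\<^sup>+\<^sup>1\<close> equal the limit.
\<close>

lemma rel_left_series_eventually_limit: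
  assumes fin: "finite (carrier B)" and I: "I \<subseteq> carrier B"
    and m: "m \<ge> 1" "left_series B m \<subseteq> I"
  shows "\<exists>N. \<forall>n\<ge>N. rel_left_series B I n = left_series_limit B"
proof -
  obtain K where K: "\<And>n. n \<ge> K \<Longrightarrow> left_series B n = left_series_limit B"
    using left_series_stabilizes [OF fin] by blast
  have "rel_left_series B I n = left_series_limit B" if "n \<ge> K" for n
    using left_series_subset_rel_left_series [OF m(2,1), of n]
      rel_left_series_subset_left_series [OF I, of n] K [of "m + n"] K [of "Suc n"] that
    by simp
  then show ?thesis by blast
qed

lemma left_nilpotent_iff:
  assumes I: "brace_ideal I B"
  shows "left_nilpotent B \<longleftrightarrow>
    left_nilpotent (B Quot I) \<and> (\<exists>n. rel_left_series B I n = {\<zero>})"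
proof
  interpret A: normal I "add_monoid B" using I by (simp add: brace_ideal_def)
  have zero: "\<zero> \<in> I" using A.one_closed by simp
  have sub: "I \<subseteq> carrier B" using A.subset by simp
  assume "left_nilpotent B"
  then obtain k where k: "left_series B (Suc k) = {\<zero>}"
    unfolding left_nilpotent_def by (metis Suc_le_D One_nat_def)
  have "left_series B (Suc k) \<subseteq> I" using k zero by simp
  moreover have "rel_left_series B I k = {\<zero>}"
    using rel_left_series_subset_left_series [OF sub, of k] k zero_in_rel_left_series [OF zero, of k]
    by auto
  ultimately show "left_nilpotent (B Quot I) \<and> (\<exists>n. rel_left_series B I n = {\<zero>})"
    unfolding left_nilpotent_quotient_iff [OF I] by (metis le_add1 plus_1_eq_Suc)
next
  assume "left_nilpotent (B Quot I) \<and> (\<exists>n. rel_left_series B I n = {\<zero>})"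
  then obtain m n where m: "m \<ge> 1" "left_series B m \<subseteq> I" and n: "rel_left_series B I n = {\<zero>}"
    unfolding left_nilpotent_quotient_iff [OF I] by blast
  have "left_series B (m + n) = {\<zero>}"
    using left_series_subset_rel_left_series [OF m(2,1), of n] n zero_in_left_series [of "m + n"]
    by auto
  then show "left_nilpotent B"
    unfolding left_nilpotent_def using m(1) by (metis trans_le_add1)
qed

end

theorem theorem7p2:
  fixes B :: "('a, 'm) ring_scheme" and I :: "'a set"
  assumes "skew_brace B"
    and "finite (carrier B)"
    and "brace_ideal I B"
  shows "(left_nilpotent (B Quot I) \<longrightarrow>
            (\<exists>N. \<forall>n\<ge>N. rel_left_series B I n = left_series_limit B)) \<and>
         (left_nilpotent B \<longleftrightarrow>
            left_nilpotent (B Quot I) \<and> (\<exists>n. rel_left_series B I n = {\<zero>\<^bsub>B\<^esub>}))"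
proof -
  interpret skew_brace B by (rule assms(1))
  have sub: "I \<subseteq> carrier B"
    using assms(3) subgroup.subset [of I "add_monoid B"] by (simp add: brace_ideal_def)
  show ?thesis
    using left_nilpotent_quotient_iff [OF assms(3)] left_nilpotent_iff [OF assms(3)]
      rel_left_series_eventually_limit [OF assms(2) sub]
    by blast
qed

end
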